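(* Let $p\in[1,+\infty)$, let $\Lambda=(\lambda_n)_{n\in\mathbb N}$ be an increasing sequence of non-negative real numbers with $\sum_{n\ge1}\frac1{\lambda_n}<+\infty$ and $\inf_n(\lambda_{n+1}-\lambda_n)>0$, let $w=(w_n)_n$ be a sequence of positive weights, and let $\mu$ be a positive finite measure on $[0,1)$. Let $D_n(p)$ and $T_\mu:\ell^p(w)\to L^p(\mu)$, $T_\mu(b)=\sum_n b_nt^{\lambda_n}$, be as defined in the context. If $(D_n(p))_n$ is a bounded sequence of real numbers, then: (i) $a_{N+1}(T_\mu)\le D_N(p)^\ast$ for every $N\in\mathbb N$; (ii) $\|T_\mu\|_p\le \sup_{n\in\mathbb N}D_n(p)$; (iii) $\|T_\mu\|_e\le\limsup_{n\to+\infty}D_n(p)$; (iv) for every $p\ge1$, $\|T_\mu\|_{\mathcal N}\le\sum_{n\ge0}w_n^{-\frac1p}\|t^{\lambda_n}\|_{L^p(\mu)}$; (v) if $p=2$, then for any $r>0$, $\|T_\mu\|_{\mathcal S^r}\le\Big(\sum_{n\ge0}D_n(2)^r\Big)^{\frac1r}$.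
   Context: $\mathbb N=\{0,1,2,\dots\}$. $\ell^p(w)$ is the Banach space of complex sequences $b=(b_n)_n$ with norm $\|b\|_{\ell^p(w)}=(\sum_n|b_n|^pw_n)^{1/p}$. For $n\in\mathbb N$, $$D_n(p)=\Bigg(\int_{[0,1)}w_n^{-\frac1p}t^{\lambda_n}\Big(\sum_{k\ge0}w_k^{-\frac1p}t^{\lambda_k}\Big)^{p-1}d\mu\Bigg)^{\frac1p}\in\mathbb R_+\cup\{+\infty\}.$$ $T_\mu:\ell^p(w)\to L^p(\mu)$ is the operator $T_\mu(b)=\sum_n b_nt^{\lambda_n}$, and $\|T_\mu\|_p$ denotes its operator norm. For a bounded sequence $(u_n)_n$ in $\mathbb R_+$, its decreasing rearrangement is $u_N^\ast=\inf_{A\subset\mathbb N,\,|A|=N}\ \sup\{u_n: n\notin A\}$; $D_N(p)^\ast$ is the decreasing rearrangement of $(D_n(p))_n$. For a bounded operator $S:X\to Y$ between separable Banach spaces: the approximation numbers are $a_n(S)=\inf\{\|S-R\|:\operatorname{rank}(R)<n\}$ for $n\ge1$; the essential norm is $\|S\|_e=\inf\{\|S-K\|: K\text{ compact}\}$; $S$ is nuclear if $S(x)=\sum_nR_n(x)$ for every $x\in X$ for some rank-one operators $R_n$ with $\sum_n\|R_n\|<\infty$, and the nuclear norm is $\|S\|_{\mathcal N}=\inf\{\sum_n\|R_n\|: \operatorname{rank}(R_n)=1,\ \sum_nR_n=S\}$. For Hilbert spaces $X,Y$ and $r>0$, $S$ belongs to the Schatten class $\mathcal S^r$ if $\sum_na_n(S)^r<\infty$,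 and $\|S\|_{\mathcal S^r}=(\sum_na_n(S)^r)^{1/r}$. In (iv) and (v) the right-hand side may be $+\infty$, in which case the inequality is void. *)

theory Defs
  imports "HOL-Analysis.Analysis"
begin

section \<open>Complex normed spaces with explicit carriers\<close>

text \<open>
  The spaces \<open>\<ell>\<^sup>p(w)\<close> and \<open>L\<^sup>p(\<mu>)\<close> depend on the parameters \<open>p\<close>, \<open>w\<close> and \<open>\<mu>\<close>, so they cannot
  be types. They are given by the data below; an operator \<open>X \<rightarrow> Y\<close> is a HOL function
  of which only the values on \<open>vcarrier X\<close> matter.
\<close>

record 'a nspace =
  vcarrier :: "'a set"
  vzero :: 'a
  vadd :: "'a \<Rightarrow> 'a \<Rightarrow> 'a"
  vscale :: "complex \<Rightarrow> 'a \<Rightarrow> 'a"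
  vnorm :: "'a \<Rightarrow> real"

definition vdiff :: "'a nspace \<Rightarrow> 'a \<Rightarrow> 'a \<Rightarrow> 'a" where
  "vdiff X x y = vadd X x (vscale X (- 1) y)"

primrec vpartial_sum :: "'a nspace \<Rightarrow> (nat \<Rightarrow> 'a) \<Rightarrow> nat \<Rightarrow> 'a" where
  "vpartial_sum X f 0 = vzero X"
| "vpartial_sum X f (Suc n) = vadd X (vpartial_sum X f n) (f n)"

inductive_set vspan :: "'a nspace \<Rightarrow> 'a set \<Rightarrow> 'a set" for X :: "'a nspace" and B :: "'a set" where
  vspan_zero: "vzero X \<in> vspan X B"
| vspan_step: "v \<in> vspan X B \<Longrightarrow> b \<in> B \<Longrightarrow> vadd X (vscale X c b) v \<in> vspan X B"

text \<open>Dimension of a linear subspace \<open>V\<close>; it is \<open>\<infinity>\<close> if \<open>V\<close> has no finite spanning set.\<close>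

definition vdim :: "'a nspace \<Rightarrow> 'a set \<Rightarrow> enat" where
  "vdim X V = (INF B\<in>{B. finite B \<and> B \<subseteq> V \<and> V \<subseteq> vspan X B}. enat (card B))"


section \<open>Bounded operators\<close>

definition bounded_op :: "'a nspace \<Rightarrow> 'b nspace \<Rightarrow> ('a \<Rightarrow> 'b) \<Rightarrow> bool" where
  "bounded_op X Y S \<longleftrightarrow>
     (\<forall>x\<in>vcarrier X. S x \<in> vcarrier Y) \<and>
     (\<forall>x\<in>vcarrier X. \<forall>y\<in>vcarrier X. S (vadd X x y) = vadd Y (S x) (S y)) \<and>
     (\<forall>c. \<forall>x\<in>vcarrier X. S (vscale X c x) = vscale Y c (S x)) \<and>
     (\<exists>C. \<forall>x\<in>vcarrier X. vnorm Y (S x) \<le> C * vnorm X x)"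

definition op_diff :: "'b nspace \<Rightarrow> ('a \<Rightarrow> 'b) \<Rightarrow> ('a \<Rightarrow> 'b) \<Rightarrow> 'a \<Rightarrow> 'b" where
  "op_diff Y S R = (\<lambda>x. vdiff Y (S x) (R x))"

definition op_norm :: "'a nspace \<Rightarrow> 'b nspace \<Rightarrow> ('a \<Rightarrow> 'b) \<Rightarrow> ennreal" where
  "op_norm X Y S = (SUP x\<in>{x\<in>vcarrier X. vnorm X x \<le> 1}. ennreal (vnorm Y (S x)))"

definition op_rank :: "'a nspace \<Rightarrow> 'b nspace \<Rightarrow> ('a \<Rightarrow> 'b) \<Rightarrow> enat" where
  "op_rank X Y S = vdim Y (S ` vcarrier X)"

definition compact_op :: "'a nspace \<Rightarrow> 'b nspace \<Rightarrow> ('a \<Rightarrow> 'b) \<Rightarrow> bool" where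
  "compact_op X Y K \<longleftrightarrow> bounded_op X Y K \<and>
     (\<forall>x :: nat \<Rightarrow> 'a. (\<forall>n. x n \<in> vcarrier X \<and> vnorm X (x n) \<le> 1) \<longrightarrow>
        (\<exists>r y. strict_mono r \<and> y \<in> vcarrier Y \<and>
               (\<lambda>n. vnorm Y (vdiff Y (K (x (r n))) y)) \<longlonglongrightarrow> 0))"

text \<open>Approximation numbers are numbered from \<open>n = 1\<close>.\<close>

definition approx_number :: "'a nspace \<Rightarrow> 'b nspace \<Rightarrow> ('a \<Rightarrow> 'b) \<Rightarrow> nat \<Rightarrow> ennreal" where
  "approx_number X Y S n =
     (INF R\<in>{R. bounded_op X Y R \<and> op_rank X Y R < enat n}. op_norm X Y (op_diff Y S R))"

definition essential_norm :: "'a nspace \<Rightarrow> 'b nspace \<Rightarrow> ('a \<Rightarrow> 'b) \<Rightarrow> ennreal" where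
  "essential_norm X Y S = (INF K\<in>{K. compact_op X Y K}. op_norm X Y (op_diff Y S K))"

text \<open>
  The operators \<open>R n\<close> have rank one or vanish. Vanishing terms stand for finite (possibly empty)
  sums of rank-one operators, so that the zero operator is nuclear even if \<open>Y = {0}\<close>.
\<close>

definition nuclear_rep :: "'a nspace \<Rightarrow> 'b nspace \<Rightarrow> ('a \<Rightarrow> 'b) \<Rightarrow> (nat \<Rightarrow> 'a \<Rightarrow> 'b) \<Rightarrow> bool" where
  "nuclear_rep X Y S R \<longleftrightarrow>
     (\<forall>n. bounded_op X Y (R n) \<and> op_rank X Y (R n) \<le> 1) \<and>
     (\<Sum>n. op_norm X Y (R n)) < \<infinity> \<and>
     (\<forall>x\<in>vcarrier X. (\<lambda>N. vnorm Y (vdiff Y (S x) (vpartial_sum Y (\<lambda>n. R n x) N))) \<longlonglongrightarrow> 0)"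

text \<open>The value is \<open>\<infinity>\<close> exactly if \<open>S\<close> is not nuclear.\<close>

definition nuclear_norm :: "'a nspace \<Rightarrow> 'b nspace \<Rightarrow> ('a \<Rightarrow> 'b) \<Rightarrow> ennreal" where
  "nuclear_norm X Y S = (INF R\<in>{R. nuclear_rep X Y S R}. \<Sum>n. op_norm X Y (R n))"

text \<open>Powers in \<open>[0,\<infinity>]\<close> with exponent \<open>a \<ge> 0\<close>; here \<open>x\<^sup>0 = 1\<close> for all \<open>x\<close>, unlike for \<open>powr\<close>.\<close>

definition epowr :: "ennreal \<Rightarrow> real \<Rightarrow> ennreal" where
  "epowr x a = (if a = 0 then 1 else if x = \<infinity> then \<infinity> else ennreal (enn2real x powr a))"

text \<open>The value is \<open>\<infinity>\<close> exactly if \<open>S\<close> is not in the Schatten class \<open>\<S>\<^sup>r\<close>, for \<open>r > 0\<close>.\<close>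

definition schatten_norm :: "real \<Rightarrow> 'a nspace \<Rightarrow> 'b nspace \<Rightarrow> ('a \<Rightarrow> 'b) \<Rightarrow> ennreal" where
  "schatten_norm r X Y S = epowr (\<Sum>n. epowr (approx_number X Y S (Suc n)) r) (1 / r)"


section \<open>The spaces \<open>\<ell>\<^sup>p(w)\<close> and \<open>L\<^sup>p(\<mu>)\<close>\<close>

definition lp_space :: "real \<Rightarrow> (nat \<Rightarrow> real) \<Rightarrow> (nat \<Rightarrow> complex) nspace" where
  "lp_space p w = \<lparr>
     vcarrier = {b. summable (\<lambda>n. norm (b n) powr p * w n)},
     vzero = (\<lambda>n. 0),
     vadd = (\<lambda>a b n. a n + b n),
     vscale = (\<lambda>c b n. c * b n),
     vnorm = (\<lambda>b. (\<Sum>n. norm (b n) powr p * w n) powr (1 / p)) \<rparr>"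

definition ae_class :: "'a measure \<Rightarrow> ('a \<Rightarrow> complex) \<Rightarrow> ('a \<Rightarrow> complex) set" where
  "ae_class M f = {g \<in> borel_measurable M. AE t in M. g t = f t}"

text \<open>
  Elements of \<open>L\<^sup>p(M)\<close> are classes modulo equality almost everywhere. The operations and the norm
  do not depend on the representatives, so the unions below are again single classes and
  \<open>the_elem\<close> is applied to a singleton.
\<close>

definition Lp_space :: "real \<Rightarrow> 'a measure \<Rightarrow> ('a \<Rightarrow> complex) set nspace" where
  "Lp_space p M = \<lparr>
     vcarrier = ae_class M ` {f \<in> borel_measurable M. integrable M (\<lambda>t. norm (f t) powr p)},
     vzero = ae_class M (\<lambda>t. 0),
     vadd = (\<lambda>F G. \<Union>f\<in>F. \<Union>g\<in>G. ae_class M (\<lambda>t. f t + g t)),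
     vscale = (\<lambda>c F. \<Union>f\<in>F. ae_class M (\<lambda>t. c * f t)),
     vnorm = (\<lambda>F. the_elem ((\<lambda>f. (\<integral>t. norm (f t) powr p \<partial>M) powr (1 / p)) ` F)) \<rparr>"


section \<open>The operator \<open>T\<^sub>\<mu>\<close> and the numbers \<open>D\<^sub>n(p)\<close>\<close>

text \<open>\<open>t\<^sup>a\<close> for \<open>t \<ge> 0\<close> and \<open>a \<ge> 0\<close>, with \<open>0\<^sup>0 = 1\<close> (whereas \<open>0 powr 0 = 0\<close>).\<close>

definition tpow :: "real \<Rightarrow> real \<Rightarrow> real" where
  "tpow t a = (if a = 0 then 1 else t powr a)"

text \<open>
  The class of the almost everywhere defined function \<open>t \<mapsto> \<Sum>n. b n * tpow t (\<Lambda> n)\<close>. If the series does not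
  converge almost everywhere, this is the empty set, which is not an element of \<open>L\<^sup>p(\<mu>)\<close>.
\<close>

definition T_op :: "real measure \<Rightarrow> (nat \<Rightarrow> real) \<Rightarrow> (nat \<Rightarrow> complex) \<Rightarrow> (real \<Rightarrow> complex) set" where
  "T_op \<mu> \<Lambda> b =
     {f \<in> borel_measurable \<mu>. AE t in \<mu>. (\<lambda>n. b n * of_real (tpow t (\<Lambda> n))) sums f t}"

definition D_num ::
    "real measure \<Rightarrow> (nat \<Rightarrow> real) \<Rightarrow> (nat \<Rightarrow> real) \<Rightarrow> real \<Rightarrow> nat \<Rightarrow> ennreal" where
  "D_num \<mu> \<Lambda> w p n =
     epowr (\<integral>\<^sup>+ t. ennreal (w n powr (- 1 / p) * tpow t (\<Lambda> n)) *
                 epowr (\<Sum>k. ennreal (w k powr (- 1 / p) * tpow t (\<Lambda> k))) (p - 1) \<partial>\<mu>) (1 / p)"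

definition decr_rearr :: "(nat \<Rightarrow> ennreal) \<Rightarrow> nat \<Rightarrow> ennreal" where
  "decr_rearr u N = (INF A\<in>{A. finite A \<and> card A = N}. SUP n\<in>- A. u n)"

end

theory Submission
  imports Defs "HOL-Complex_Analysis.Great_Picard"
begin

text \<open>
  With \<open>a\<^sub>n(t) = w\<^sub>n powr (-1/p) * t powr \<Lambda>\<^sub>n\<close>, Hoelder's inequality for the weights \<open>a\<^sub>n(t)\<close> gives
  \<open>\<bar>\<Sum> b\<^sub>n t powr \<Lambda>\<^sub>n\<bar> powr p \<le> (\<Sum> \<bar>b\<^sub>n\<bar> powr p * w\<^sub>n * a\<^sub>n(t)) * (\<Sum> a\<^sub>k(t)) powr (p-1)\<close>, and integrating yields
  \<open>\<parallel>T b\<parallel> \<le> c * \<parallel>b\<parallel>\<close> whenever \<open>D\<^sub>n(p) \<le> c\<close> on the support of \<open>b\<close>. Subtracting from \<open>T\<close> its composition with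
  the projection onto finitely many coordinates, which has finite rank, leaves an operator of norm at most
  the supremum of \<open>D\<^sub>n(p)\<close> over the remaining coordinates; this gives (i)-(iii). For (iv), the series
  of the one-coordinate parts of \<open>T\<close> is a nuclear representation. For (v), if \<open>\<Sum> D\<^sub>n(2) powr r\<close> is finite,
  then suprema of \<open>D\<^sub>n(2)\<close> over nonempty index sets are attained, and removing a maximising index at each
  step compares the sum of the powers of the decreasing rearrangement with a partial sum.
\<close>

section \<open>Powers with values in [0,\<infinity>]\<close>

lemma epowr_mono: "x \<le> y \<Longrightarrow> 0 \<le> a \<Longrightarrow> epowr x a \<le> epowr y a"
  by (cases x; cases y) (auto simp: epowr_def top_unique intro!: ennreal_leI powr_mono2)

lemma epowr_ennreal: "0 \<le> x \<Longrightarrow> a \<noteq> 0 \<Longrightarrow> epowr (ennreal x) a = ennreal (x powr a)"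
  by (simp add: epowr_def)

text \<open>Equality fails for \<open>x = 0\<close> and \<open>a = 0\<close>, where
  \<open>powr\<close> gives 0 and \<open>epowr\<close> gives 1. This case arises for exponent
  \<open>p - 1\<close> with \<open>p = 1\<close>.\<close>

lemma ennreal_powr_le_epowr: "0 \<le> x \<Longrightarrow> ennreal (x powr a) \<le> epowr (ennreal x) a"
  by (cases "x = 0") (auto simp: epowr_def)

lemma epowr_epowr_inverse: "0 < a \<Longrightarrow> epowr (epowr x (1 / a)) a = x"
  by (cases x) (auto simp: epowr_def powr_powr)

lemma epowr_eq_0_iff: "0 < a \<Longrightarrow> epowr x a = 0 \<longleftrightarrow> x = 0"
  by (cases x) (auto simp: epowr_def)

lemma epowr_le_epowr_iff: "0 < a \<Longrightarrow> epowr x a \<le> epowr y a \<longleftrightarrow> x \<le> y"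
  using epowr_mono[of x y a] epowr_mono[of "epowr x a" "epowr y a" "1 / a"]
    epowr_epowr_inverse[of "1 / a" x] epowr_epowr_inverse[of "1 / a" y] by auto

lemma borel_measurable_epowr [measurable]: "(\<lambda>x. epowr x a) \<in> borel_measurable borel"
  unfolding epowr_def by measurable

section \<open>Hoelder's inequality with weights, for finite sums and for series\<close>

lemma powr_sum_le_pos:
  fixes p :: real
  assumes "finite I" "1 \<le> p" "\<And>i. i \<in> I \<Longrightarrow> 0 < x i" "\<And>i. i \<in> I \<Longrightarrow> 0 \<le> a i"
  shows "(\<Sum>i\<in>I. x i * a i) powr p \<le> (\<Sum>i\<in>I. x i powr p * a i) * (\<Sum>i\<in>I. a i) powr (p - 1)"
proof (cases "(\<Sum>i\<in>I. a i) = 0")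
  case True
  then have "\<And>i. i \<in> I \<Longrightarrow> a i = 0" using assms by (simp add: sum_nonneg_eq_0_iff)
  then show ?thesis by simp
next
  case False
  define s where "s = (\<Sum>i\<in>I. a i)"
  have s: "0 < s" using False assms unfolding s_def by (simp add: sum_nonneg order_less_le)
  have ne: "I \<noteq> {}" using False by auto
  have 1: "(\<Sum>i\<in>I. a i / s) = 1" using s by (simp flip: sum_divide_distrib s_def)
  \<comment> \<open>Jensen's inequality for the convex function \<open>x powr p\<close> and the
    probability weights \<open>a i / s\<close>. Clearing denominators then turns
    \<open>s powr p / s\<close> into \<open>s powr (p - 1)\<close>.\<close>
  have "(\<Sum>i\<in>I. (a i / s) *\<^sub>R x i) powr p \<le> (\<Sum>i\<in>I. (a i / s) * x i powr p)"
    by (rule convex_on_sum[OF assms(1) ne powr_convex[OF assms(2)] 1]) (use assms s in auto)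
  also have "(\<Sum>i\<in>I. (a i / s) * x i powr p) = (\<Sum>i\<in>I. x i powr p * a i) / s"
    by (simp add: sum_divide_distrib mult.commute)
  also have "(\<Sum>i\<in>I. (a i / s) *\<^sub>R x i) = (\<Sum>i\<in>I. x i * a i) / s"
    by (simp add: sum_divide_distrib mult.commute)
  also have "((\<Sum>i\<in>I. x i * a i) / s) powr p = (\<Sum>i\<in>I. x i * a i) powr p / s powr p"
    using s assms by (simp add: powr_divide sum_nonneg less_imp_le)
  finally have "(\<Sum>i\<in>I. x i * a i) powr p \<le> (\<Sum>i\<in>I. x i powr p * a i) / s * s powr p"
    using s by (simp add: pos_divide_le_eq)
  also have "\<dots> = (\<Sum>i\<in>I. x i powr p * a i) * s powr (p - 1)"
    using s by (simp add: powr_diff)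
  finally show ?thesis by (simp add: s_def)
qed

text \<open>Indices with \<open>x i = 0\<close> contribute nothing to the left side or to the first
  factor, and restoring them only enlarges the second factor, whose exponent \<open>p - 1\<close> is
  non-negative.\<close>

lemma powr_sum_le:
  fixes p :: real
  assumes "finite I" "1 \<le> p" "\<And>i. i \<in> I \<Longrightarrow> 0 \<le> x i" "\<And>i. i \<in> I \<Longrightarrow> 0 \<le> a i"
  shows "(\<Sum>i\<in>I. x i * a i) powr p \<le> (\<Sum>i\<in>I. x i powr p * a i) * (\<Sum>i\<in>I. a i) powr (p - 1)"
proof -
  define J where "J = {i \<in> I. 0 < x i}"
  have J: "finite J" "J \<subseteq> I" using assms by (auto simp: J_def)
  have 0: "x i = 0" if "i \<in> I - J" for i
    using that assms(3)[of i] by (auto simp: J_def)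
  have "(\<Sum>i\<in>I. x i * a i) = (\<Sum>i\<in>J. x i * a i)"
    by (rule sum.mono_neutral_right) (use assms J 0 in auto)
  then have "(\<Sum>i\<in>I. x i * a i) powr p \<le> (\<Sum>i\<in>J. x i powr p * a i) * (\<Sum>i\<in>J. a i) powr (p - 1)"
    using powr_sum_le_pos[OF J(1) assms(2), of x a] assms(4) by (simp add: J_def)
  also have "(\<Sum>i\<in>J. x i powr p * a i) = (\<Sum>i\<in>I. x i powr p * a i)"
    by (rule sum.mono_neutral_left) (use assms J 0 in auto)
  also have "(\<Sum>i\<in>J. a i) powr (p - 1) \<le> (\<Sum>i\<in>I. a i) powr (p - 1)"
    by (rule powr_mono2) (use assms J in \<open>auto intro!: sum_nonneg sum_mono2\<close>)
  finally show ?thesis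
    using assms by (auto simp: mult_left_mono sum_nonneg)
qed

text \<open>The finite inequality bounds every partial sum by the same number, so convergence comes
  out together with the estimate. Finiteness is assumed for the product, since one factor may be
  infinite when the other is 0.\<close>

lemma powr_suminf_le:
  fixes p :: real
  assumes p: "1 \<le> p" and x: "\<And>n. 0 \<le> x n" and a: "\<And>n. 0 \<le> a n"
    and fin: "(\<Sum>n. ennreal (x n powr p * a n)) * epowr (\<Sum>n. ennreal (a n)) (p - 1) < \<infinity>"
  shows "summable (\<lambda>n. x n * a n)"
    and "ennreal ((\<Sum>n. x n * a n) powr p)
      \<le> (\<Sum>n. ennreal (x n powr p * a n)) * epowr (\<Sum>n. ennreal (a n)) (p - 1)" (is "_ \<le> ?G")
proof -
  obtain g where g: "0 \<le> g" "?G = ennreal g" using fin by (cases ?G) auto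
  have "(\<Sum>n<N. x n * a n) powr p \<le> g" for N
  proof -
    have "ennreal ((\<Sum>n<N. x n * a n) powr p)
        \<le> ennreal (\<Sum>n<N. x n powr p * a n) * ennreal ((\<Sum>n<N. a n) powr (p - 1))"
      using powr_sum_le[of "{..<N}" p x a] p x a by (simp add: ennreal_leI sum_nonneg flip: ennreal_mult)
    also have "\<dots> \<le> (\<Sum>n<N. ennreal (x n powr p * a n)) * epowr (\<Sum>n<N. ennreal (a n)) (p - 1)"
      using ennreal_powr_le_epowr[of "\<Sum>n<N. a n" "p - 1"] a x
      by (auto simp: sum_nonneg intro!: mult_left_mono)
    also have "\<dots> \<le> ?G"
      using p by (intro mult_mono epowr_mono sum_le_suminf) auto
    finally show ?thesis using g by simp
  qed
  then have le: "(\<Sum>n<N. x n * a n) \<le> g powr (1 / p)" for N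
    using powr_mono2[of "1 / p" "(\<Sum>n<N. x n * a n) powr p" g] p x a
    by (simp add: powr_powr sum_nonneg)
  then show sm: "summable (\<lambda>n. x n * a n)"
    by (intro summableI_nonneg_bounded) (use x a in auto)
  have "(\<Sum>n. x n * a n) \<le> g powr (1 / p)" using sm le by (rule suminf_le_const)
  then have "(\<Sum>n. x n * a n) powr p \<le> (g powr (1 / p)) powr p"
    using p x a sm by (intro powr_mono2 suminf_nonneg) auto
  then show "ennreal ((\<Sum>n. x n * a n) powr p) \<le> ?G"
    using g p by (simp add: powr_powr ennreal_leI)
qed

section \<open>Power sums of the decreasing rearrangement\<close>

lemma SUP_attained_if_summable:
  fixes u :: "nat \<Rightarrow> ennreal"
  assumes r: "0 < r" and fin: "(\<Sum>n. epowr (u n) r) < \<infinity>" and A: "A \<noteq> {}"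
  obtains m where "m \<in> A" "(SUP n\<in>A. u n) \<le> u m"
proof (cases "\<exists>k\<in>A. u k \<noteq> 0")
  case False
  then show ?thesis using A that by (metis SUP_least ex_in_conv order_refl)
next
  case True
  then obtain k where k: "k \<in> A" "u k \<noteq> 0" by auto
  \<comment> \<open>The powers are finite, so they form a summable real sequence tending to 0. Only
    finitely many of them reach the positive level \<open>v k\<close>.\<close>
  define v where "v n = enn2real (epowr (u n) r)" for n
  have "epowr (u n) r < \<infinity>" for n using fin by (rule ennreal_suminf_lessD)
  then have v: "epowr (u n) r = ennreal (v n)" for n by (simp add: v_def less_top)
  have v0: "0 \<le> v n" for n by (simp add: v_def)
  have "summable v" using fin v0 by (intro summable_suminf_not_top) (auto simp: v)
  then have "v \<longlonglongrightarrow> 0" by (rule summable_LIMSEQ_zero)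
  moreover have "0 < v k"
    using k r epowr_eq_0_iff[of r "u k"] v[of k] v0[of k] by (cases "v k = 0") auto
  ultimately have "\<forall>\<^sub>F n in sequentially. v n < v k" by (rule order_tendstoD)
  then obtain N where N: "\<And>n. n \<ge> N \<Longrightarrow> v n < v k" by (auto simp: eventually_sequentially)
  \<comment> \<open>A maximum over the finite set \<open>B\<close> is a maximum over
    \<open>A\<close>, because off \<open>B\<close> the values stay below \<open>v k\<close>.\<close>
  define B where "B = {n \<in> A. v k \<le> v n}"
  have B: "finite B" "k \<in> B"
    using N k finite_subset[of B "{..<N}"] by (force simp: B_def not_le[symmetric])+
  then have "Max (v ` B) \<in> v ` B" by (intro Max_in) auto
  then obtain m where m: "m \<in> B" "v m = Max (v ` B)" by auto
  have "v n \<le> v m" if "n \<in> A" for n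
  proof (cases "n \<in> B")
    case True then show ?thesis using B m by simp
  next
    case False
    then have "v n \<le> v k" using that by (simp add: B_def)
    also have "v k \<le> v m" using B m by simp
    finally show ?thesis .
  qed
  then have "u n \<le> u m" if "n \<in> A" for n
    using that r epowr_le_epowr_iff[of r "u n" "u m"] by (simp add: v ennreal_leI)
  then show ?thesis using m that[of m] by (auto simp: B_def intro: SUP_least)
qed

lemma suminf_epowr_decr_rearr_le:
  assumes r: "0 < r"
  shows "(\<Sum>N. epowr (decr_rearr u N) r) \<le> (\<Sum>n. epowr (u n) r)"
proof (cases "(\<Sum>n. epowr (u n) r) < \<infinity>")
  case fin: True
  \<comment> \<open>\<open>A\<close> collects the indices removed in the first \<open>M\<close>
    steps. It competes in the infimum defining \<open>decr_rearr u M\<close>, which is therefore at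
    most the maximum \<open>u m\<close> over the remaining indices. Adding \<open>m\<close> keeps
    the indices distinct.\<close>
  have "\<exists>A. finite A \<and> card A = M \<and> (\<Sum>N<M. epowr (decr_rearr u N) r) \<le> (\<Sum>n\<in>A. epowr (u n) r)" for M
  proof (induction M)
    case (Suc M)
    then obtain A where A: "finite A" "card A = M"
      "(\<Sum>N<M. epowr (decr_rearr u N) r) \<le> (\<Sum>n\<in>A. epowr (u n) r)" by auto
    have "- A \<noteq> {}" using A(1) by (metis Compl_eq_Diff_UNIV Diff_infinite_finite finite.emptyI infinite_UNIV_nat)
    from SUP_attained_if_summable[OF r fin this] obtain m
      where m: "m \<in> - A" "(SUP n\<in>- A. u n) \<le> u m" by blast
    have "decr_rearr u M \<le> (SUP n\<in>- A. u n)"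
      unfolding decr_rearr_def by (rule INF_lower) (use A in auto)
    also note m(2)
    finally have "epowr (decr_rearr u M) r \<le> epowr (u m) r" using r by (intro epowr_mono) auto
    then show ?case
      using A m by (intro exI[of _ "insert m A"]) (auto simp: add.commute intro!: add_mono)
  qed auto
  then have "(\<Sum>N<M. epowr (decr_rearr u N) r) \<le> (\<Sum>n. epowr (u n) r)" for M
    by (meson order_trans sum_le_suminf summableI zero_le)
  then show ?thesis by (intro suminf_le_const) auto
qed (simp add: not_less top_unique)

section \<open>Computing in \<open>L\<^sup>p\<close> through representatives\<close>

lemma ae_class_cong: "AE t in M. f t = g t \<Longrightarrow> ae_class M f = ae_class M g"
proof -
  assume "AE t in M. f t = g t"
  then have "(AE t in M. h t = f t) \<longleftrightarrow> (AE t in M. h t = g t)" for h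
    by (intro eventually_subst) (auto elim: eventually_mono)
  then show ?thesis by (simp add: ae_class_def)
qed

lemma ae_class_self: "f \<in> borel_measurable M \<Longrightarrow> f \<in> ae_class M f"
  by (simp add: ae_class_def)

lemma Lp_space_zero: "vzero (Lp_space p M) = ae_class M (\<lambda>t. 0)"
  by (simp add: Lp_space_def)

text \<open>Every choice of representatives yields the same class, so the union over the nonempty
  classes collapses to that class.\<close>

lemma Lp_space_add:
  assumes "f \<in> borel_measurable M" "g \<in> borel_measurable M"
  shows "vadd (Lp_space p M) (ae_class M f) (ae_class M g) = ae_class M (\<lambda>t. f t + g t)"
proof -
  have *: "ae_class M (\<lambda>t. f' t + g' t) = ae_class M (\<lambda>t. f t + g t)"
    if "f' \<in> ae_class M f" "g' \<in> ae_class M g" for f' g'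
    using that by (intro ae_class_cong) (force simp: ae_class_def elim: AE_mp)
  have "ae_class M f \<noteq> {}" "ae_class M g \<noteq> {}"
    using ae_class_self[OF assms(1)] ae_class_self[OF assms(2)] by auto
  then show ?thesis
    unfolding Lp_space_def nspace.simps by (intro SUP_eq_const *)
qed

lemma Lp_space_scale:
  assumes "f \<in> borel_measurable M"
  shows "vscale (Lp_space p M) c (ae_class M f) = ae_class M (\<lambda>t. c * f t)"
proof -
  have *: "ae_class M (\<lambda>t. c * f' t) = ae_class M (\<lambda>t. c * f t)" if "f' \<in> ae_class M f" for f'
    using that by (intro ae_class_cong) (force simp: ae_class_def elim: AE_mp)
  have "ae_class M f \<noteq> {}" using ae_class_self[OF assms] by auto
  then show ?thesis
    unfolding Lp_space_def nspace.simps by (intro SUP_eq_const *)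
qed

lemma Lp_space_diff:
  assumes [measurable]: "f \<in> borel_measurable M" "g \<in> borel_measurable M"
  shows "vdiff (Lp_space p M) (ae_class M f) (ae_class M g) = ae_class M (\<lambda>t. f t - g t)"
  by (simp add: vdiff_def Lp_space_scale Lp_space_add)

lemma Lp_space_norm:
  assumes "f \<in> borel_measurable M"
  shows "vnorm (Lp_space p M) (ae_class M f) = (\<integral>t. norm (f t) powr p \<partial>M) powr (1 / p)"
proof -
  have *: "(\<integral>t. norm (g t) powr p \<partial>M) = (\<integral>t. norm (f t) powr p \<partial>M)" if "g \<in> ae_class M f" for g
    using that assms by (intro integral_cong_AE) (auto simp: ae_class_def)
  have "(\<lambda>g. (\<integral>t. norm (g t) powr p \<partial>M) powr (1 / p)) ` ae_class M f
      = (\<lambda>g. (\<integral>t. norm (f t) powr p \<partial>M) powr (1 / p)) ` ae_class M f"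
    by (rule image_cong[OF refl]) (simp only: *)
  also have "\<dots> = {(\<integral>t. norm (f t) powr p \<partial>M) powr (1 / p)}"
    using ae_class_self[OF assms] by auto
  finally show ?thesis by (simp add: Lp_space_def)
qed

text \<open>One bound on the non-negative integral gives both integrability and the norm
  estimate.\<close>

lemma Lp_space_nn_integral_bound:
  assumes [measurable]: "f \<in> borel_measurable M" and p: "0 < p"
    and K: "0 \<le> K" "(\<integral>\<^sup>+ t. ennreal (norm (f t) powr p) \<partial>M) \<le> ennreal K"
  shows "ae_class M f \<in> vcarrier (Lp_space p M)"
    and "vnorm (Lp_space p M) (ae_class M f) \<le> K powr (1 / p)"
proof -
  have "integrable M (\<lambda>t. norm (f t) powr p)"
    using K by (intro integrableI_bounded) (auto simp: top_unique less_top[symmetric])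
  moreover from this have "(\<integral>t. norm (f t) powr p \<partial>M) \<le> K"
    using K by (subst (asm) nn_integral_eq_integral) auto
  ultimately show "ae_class M f \<in> vcarrier (Lp_space p M)"
    "vnorm (Lp_space p M) (ae_class M f) \<le> K powr (1 / p)"
    using p by (auto simp: Lp_space_norm intro!: powr_mono2) (simp add: Lp_space_def)
qed

section \<open>Monomials, coordinates and operator norms\<close>

lemma tpow_nonneg [simp]: "0 \<le> tpow t a"
  by (simp add: tpow_def)

lemma borel_measurable_tpow: "(\<lambda>t. tpow t a) \<in> borel_measurable borel"
  by (cases "a = 0") (simp_all add: tpow_def)

text \<open>The coordinate projection onto \<open>A\<close>. Composing \<open>T\<close> with it
  yields all approximating operators below.\<close>

definition restrict_coords :: "nat set \<Rightarrow> (nat \<Rightarrow> complex) \<Rightarrow> nat \<Rightarrow> complex" where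
  "restrict_coords A b = (\<lambda>n. if n \<in> A then b n else 0)"

lemma vcarrier_lp_space: "b \<in> vcarrier (lp_space p w) \<longleftrightarrow> summable (\<lambda>n. norm (b n) powr p * w n)"
  by (simp add: lp_space_def)

lemma vnorm_lp_space: "vnorm (lp_space p w) b = (\<Sum>n. norm (b n) powr p * w n) powr (1 / p)"
  by (simp add: lp_space_def)

lemma vadd_lp_space: "vadd (lp_space p w) a b = (\<lambda>n. a n + b n)"
  by (simp add: lp_space_def)

lemma vscale_lp_space: "vscale (lp_space p w) c b = (\<lambda>n. c * b n)"
  by (simp add: lp_space_def)

lemma op_norm_le:
  assumes "\<And>b. b \<in> vcarrier X \<Longrightarrow> vnorm Y (S b) \<le> c * vnorm X b" "0 \<le> c"
  shows "op_norm X Y S \<le> ennreal c"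
  unfolding op_norm_def
proof (rule SUP_least)
  fix b assume b: "b \<in> {b \<in> vcarrier X. vnorm X b \<le> 1}"
  then have "vnorm Y (S b) \<le> c * vnorm X b" using assms by auto
  also have "\<dots> \<le> c * 1" using b assms(2) by (intro mult_left_mono) auto
  finally show "ennreal (vnorm Y (S b)) \<le> ennreal c" by (simp add: ennreal_leI)
qed

section \<open>The basic estimate for the series\<close>

locale bounded_D_num =
  fixes p :: real and \<Lambda> w :: "nat \<Rightarrow> real" and \<mu> :: "real measure" and C :: real
  assumes p: "1 \<le> p"
    and w_pos: "\<And>n. 0 < w n"
    and mu_sets: "sets \<mu> = sets (restrict_space borel {0..<1})"
    and C_nonneg: "0 \<le> C"
    and D_le_C: "\<And>n. D_num \<mu> \<Lambda> w p n \<le> ennreal C"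
begin

abbreviation "X \<equiv> lp_space p w"
abbreviation "Y \<equiv> Lp_space p \<mu>"
abbreviation "T \<equiv> T_op \<mu> \<Lambda>"
abbreviation "D \<equiv> D_num \<mu> \<Lambda> w p"

text \<open>An everywhere defined representative of \<open>T b\<close>. Where the series diverges
  its value is arbitrary, which for \<open>b\<close> in \<open>\<ell>\<^sup>p(w)\<close> concerns
  only a null set.\<close>

definition series_fun :: "(nat \<Rightarrow> complex) \<Rightarrow> real \<Rightarrow> complex" where
  "series_fun b t = (\<Sum>n. b n * of_real (tpow t (\<Lambda> n)))"

lemma borel_measurable_tpow_mu [measurable]: "(\<lambda>t. tpow t a) \<in> borel_measurable \<mu>"
  using measurable_restrict_space1[OF borel_measurable_tpow]
  by (simp add: measurable_cong_sets[OF mu_sets refl])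

lemma borel_measurable_series_fun [measurable]: "series_fun b \<in> borel_measurable \<mu>"
  unfolding series_fun_def by measurable

lemma epowr_D:
  "epowr (D n) p = (\<integral>\<^sup>+ t. ennreal (w n powr (- 1 / p) * tpow t (\<Lambda> n)) *
     epowr (\<Sum>k. ennreal (w k powr (- 1 / p) * tpow t (\<Lambda> k))) (p - 1) \<partial>\<mu>)"
  unfolding D_num_def using p by (intro epowr_epowr_inverse) auto

text \<open>Pointwise Hoelder followed by termwise integration. The bound on \<open>D\<close> is
  imposed only on the support of \<open>b\<close>, so that restricting to \<open>A\<close> later
  yields the supremum over \<open>A\<close> alone.\<close>

lemma series_estimate:
  assumes b: "b \<in> vcarrier X" and c: "0 \<le> c" and Dc: "\<And>n. b n \<noteq> 0 \<Longrightarrow> D n \<le> ennreal c"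
  shows "AE t in \<mu>. summable (\<lambda>n. norm (b n) * tpow t (\<Lambda> n))"
    and "(\<integral>\<^sup>+ t. ennreal ((\<Sum>n. norm (b n) * tpow t (\<Lambda> n)) powr p) \<partial>\<mu>)
      \<le> ennreal (c powr p * (\<Sum>n. norm (b n) powr p * w n))"
proof -
  \<comment> \<open>The weight is split so that \<open>x n * a n t\<close> is the modulus of the
    n-th term of the series, while \<open>x n powr p\<close> is the n-th term of the norm series of
    \<open>b\<close>.\<close>
  define x where "x n = norm (b n) * w n powr (1 / p)" for n
  define a where "a n t = w n powr (- 1 / p) * tpow t (\<Lambda> n)" for n t
  define W where "W t = epowr (\<Sum>k. ennreal (a k t)) (p - 1)" for t
  define G where "G t = (\<Sum>n. ennreal (x n powr p * a n t)) * W t" for t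
  have [measurable]: "a n \<in> borel_measurable \<mu>" for n
    unfolding a_def[abs_def] by measurable
  have [measurable]: "W \<in> borel_measurable \<mu>"
    unfolding W_def[abs_def] by measurable
  have x0: "0 \<le> x n" and a0: "0 \<le> a n t" for n t
    by (simp_all add: x_def a_def)
  have xa: "x n * a n t = norm (b n) * tpow t (\<Lambda> n)" for n t
  proof -
    have "w n powr (1 / p) * w n powr (- 1 / p) = 1"
      using w_pos[of n] by (simp flip: powr_add)
    then show ?thesis by (simp add: x_def a_def algebra_simps)
  qed
  have xp: "x n powr p = norm (b n) powr p * w n" for n
    using p w_pos[of n] by (simp add: x_def powr_mult powr_powr)
  have sum_b: "summable (\<lambda>n. norm (b n) powr p * w n)"
    using b by (simp add: vcarrier_lp_space)
  have eD: "epowr (D n) p = (\<integral>\<^sup>+ t. ennreal (a n t) * W t \<partial>\<mu>)" for n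
    by (simp add: epowr_D a_def W_def)
  \<comment> \<open>Moving \<open>W t\<close> inside the sum makes the integral of the n-th summand
    equal to \<open>x n powr p\<close> times the p-th power of \<open>D n\<close>.\<close>
  have G_eq: "G t = (\<Sum>n. ennreal (x n powr p) * (ennreal (a n t) * W t))" for t
    unfolding G_def by (simp add: ennreal_mult a0 mult.assoc flip: ennreal_suminf_multc)
  have "(\<integral>\<^sup>+ t. G t \<partial>\<mu>) = (\<Sum>n. \<integral>\<^sup>+ t. ennreal (x n powr p) * (ennreal (a n t) * W t) \<partial>\<mu>)"
    unfolding G_eq by (rule nn_integral_suminf) measurable
  also have "\<dots> = (\<Sum>n. ennreal (x n powr p) * epowr (D n) p)"
    by (simp add: nn_integral_cmult eD)
  also have "\<dots> \<le> (\<Sum>n. ennreal (c powr p * (norm (b n) powr p * w n)))"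
  proof (intro suminf_le summableI)
    fix n
    show "ennreal (x n powr p) * epowr (D n) p \<le> ennreal (c powr p * (norm (b n) powr p * w n))"
    proof (cases "b n = 0")
      case False
      have "ennreal (x n powr p) * epowr (D n) p \<le> ennreal (x n powr p) * epowr (ennreal c) p"
        using p by (intro mult_left_mono epowr_mono Dc False) auto
      also have "\<dots> = ennreal (c powr p * (norm (b n) powr p * w n))"
        using p c w_pos[of n] by (simp add: epowr_ennreal xp mult.commute less_imp_le flip: ennreal_mult)
      finally show ?thesis .
    qed (simp add: x_def)
  qed
  also have "\<dots> = ennreal (c powr p * (\<Sum>n. norm (b n) powr p * w n))"
    using w_pos sum_b by (subst suminf_ennreal2) (auto simp: less_imp_le suminf_mult intro!: summable_mult)
  finally have int_G: "(\<integral>\<^sup>+ t. G t \<partial>\<mu>) \<le> ennreal (c powr p * (\<Sum>n. norm (b n) powr p * w n))" .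
  have "G \<in> borel_measurable \<mu>"
    unfolding G_def[abs_def] by measurable
  \<comment> \<open>A finite integral forces \<open>G\<close> to be finite almost everywhere, which
    is the hypothesis of the pointwise inequality.\<close>
  then have fin: "AE t in \<mu>. G t < \<infinity>"
    using int_G by (auto simp: less_top[symmetric] top_unique dest!: nn_integral_PInf_AE)
  have step: "summable (\<lambda>n. norm (b n) * tpow t (\<Lambda> n))"
    "ennreal ((\<Sum>n. norm (b n) * tpow t (\<Lambda> n)) powr p) \<le> G t" if "G t < \<infinity>" for t
    using powr_suminf_le[of p x "\<lambda>n. a n t", OF p x0 a0] that by (simp_all add: G_def W_def xa)
  show "AE t in \<mu>. summable (\<lambda>n. norm (b n) * tpow t (\<Lambda> n))"
    using fin by eventually_elim (rule step)
  have "(\<integral>\<^sup>+ t. ennreal ((\<Sum>n. norm (b n) * tpow t (\<Lambda> n)) powr p) \<partial>\<mu>) \<le> (\<integral>\<^sup>+ t. G t \<partial>\<mu>)"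
    by (rule nn_integral_mono_AE) (use fin step in \<open>auto elim!: eventually_mono\<close>)
  then show "(\<integral>\<^sup>+ t. ennreal ((\<Sum>n. norm (b n) * tpow t (\<Lambda> n)) powr p) \<partial>\<mu>)
      \<le> ennreal (c powr p * (\<Sum>n. norm (b n) powr p * w n))"
    using int_G by (rule order_trans)
qed

section \<open>\<open>T\<close> as a bounded linear operator\<close>

lemma T_op_summable:
  assumes "b \<in> vcarrier X"
  shows "AE t in \<mu>. summable (\<lambda>n. norm (b n * of_real (tpow t (\<Lambda> n))))"
  using series_estimate(1)[OF assms C_nonneg D_le_C] by (simp add: norm_mult)

lemma T_op_sums:
  assumes "b \<in> vcarrier X"
  shows "AE t in \<mu>. (\<lambda>n. b n * of_real (tpow t (\<Lambda> n))) sums series_fun b t"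
  using T_op_summable[OF assms]
  by eventually_elim (simp add: series_fun_def summable_norm_cancel summable_sums)

text \<open>Limits are unique, so any almost everywhere sum determines the class. Linearity of
  \<open>T\<close> thereby reduces to pointwise series arithmetic.\<close>

lemma T_op_eqI:
  assumes "AE t in \<mu>. (\<lambda>n. b n * of_real (tpow t (\<Lambda> n))) sums f t"
  shows "T b = ae_class \<mu> f"
proof -
  have "(AE t in \<mu>. (\<lambda>n. b n * of_real (tpow t (\<Lambda> n))) sums g t)
      \<longleftrightarrow> (AE t in \<mu>. g t = f t)" for g
    using assms by (intro eventually_subst) (auto elim!: eventually_mono dest: sums_unique2)
  then show ?thesis by (simp add: T_op_def ae_class_def)
qed

lemma T_op_eq: "b \<in> vcarrier X \<Longrightarrow> T b = ae_class \<mu> (series_fun b)"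
  by (intro T_op_eqI T_op_sums)

lemma T_op_bound:
  assumes b: "b \<in> vcarrier X" and c: "0 \<le> c" and Dc: "\<And>n. b n \<noteq> 0 \<Longrightarrow> D n \<le> ennreal c"
  shows "T b \<in> vcarrier Y" and "vnorm Y (T b) \<le> c * vnorm X b"
proof -
  let ?S = "\<Sum>n. norm (b n) powr p * w n"
  have S: "0 \<le> ?S"
    using b w_pos by (intro suminf_nonneg) (auto simp: vcarrier_lp_space less_imp_le)
  have "AE t in \<mu>. norm (series_fun b t) \<le> (\<Sum>n. norm (b n) * tpow t (\<Lambda> n))"
    using T_op_summable[OF b]
  proof eventually_elim
    case (elim t)
    then show ?case using summable_norm[OF elim] by (simp add: series_fun_def norm_mult)
  qed
  then have "(\<integral>\<^sup>+ t. ennreal (norm (series_fun b t) powr p) \<partial>\<mu>)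
      \<le> (\<integral>\<^sup>+ t. ennreal ((\<Sum>n. norm (b n) * tpow t (\<Lambda> n)) powr p) \<partial>\<mu>)"
    using p by (intro nn_integral_mono_AE) (auto elim!: eventually_mono intro!: ennreal_leI powr_mono2)
  also have "\<dots> \<le> ennreal (c powr p * ?S)"
    by (rule series_estimate(2)[OF b c Dc])
  finally have *: "(\<integral>\<^sup>+ t. ennreal (norm (series_fun b t) powr p) \<partial>\<mu>) \<le> ennreal (c powr p * ?S)" .
  have eq: "(c powr p * ?S) powr (1 / p) = c * vnorm X b"
    using p c S by (simp add: powr_mult powr_powr vnorm_lp_space)
  show "T b \<in> vcarrier Y" "vnorm Y (T b) \<le> c * vnorm X b"
    using Lp_space_nn_integral_bound[OF borel_measurable_series_fun _ _ *] p S
    by (simp_all add: T_op_eq[OF b] eq)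
qed

lemma T_op_add:
  assumes "a \<in> vcarrier X" "b \<in> vcarrier X"
  shows "T (\<lambda>n. a n + b n) = vadd Y (T a) (T b)"
proof -
  have "T (\<lambda>n. a n + b n) = ae_class \<mu> (\<lambda>t. series_fun a t + series_fun b t)"
    using T_op_sums[OF assms(1)] T_op_sums[OF assms(2)]
    by (intro T_op_eqI, eventually_elim) (auto simp: ring_distribs intro: sums_add)
  then show ?thesis by (simp add: T_op_eq assms Lp_space_add)
qed

lemma T_op_scale:
  assumes "b \<in> vcarrier X"
  shows "T (\<lambda>n. c * b n) = vscale Y c (T b)"
proof -
  have "T (\<lambda>n. c * b n) = ae_class \<mu> (\<lambda>t. c * series_fun b t)"
    using T_op_sums[OF assms]
    by (intro T_op_eqI, eventually_elim) (auto simp: mult.assoc intro: sums_mult)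
  then show ?thesis by (simp add: T_op_eq assms Lp_space_scale)
qed

lemma T_op_diff:
  assumes "a \<in> vcarrier X" "b \<in> vcarrier X"
  shows "vdiff Y (T a) (T b) = T (\<lambda>n. a n - b n)"
proof -
  have "T (\<lambda>n. a n - b n) = ae_class \<mu> (\<lambda>t. series_fun a t - series_fun b t)"
    using T_op_sums[OF assms(1)] T_op_sums[OF assms(2)]
    by (intro T_op_eqI, eventually_elim) (auto simp: ring_distribs intro: sums_diff)
  then show ?thesis by (simp add: T_op_eq assms Lp_space_diff)
qed

section \<open>Restrictions of \<open>T\<close> to sets of coordinates\<close>

lemma restrict_coords_carrier:
  assumes "b \<in> vcarrier X"
  shows "restrict_coords A b \<in> vcarrier X"
  unfolding vcarrier_lp_space
  by (rule summable_comparison_test'[of "\<lambda>n. norm (b n) powr p * w n"])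
    (use assms w_pos in \<open>auto simp: vcarrier_lp_space restrict_coords_def less_imp_le\<close>)

lemma restrict_coords_finite_carrier:
  assumes "finite A"
  shows "restrict_coords A b \<in> vcarrier X"
  unfolding vcarrier_lp_space
  by (rule summable_finite[OF assms]) (simp add: restrict_coords_def)

lemma vnorm_restrict_coords_le:
  assumes "b \<in> vcarrier X"
  shows "vnorm X (restrict_coords A b) \<le> vnorm X b"
  unfolding vnorm_lp_space
  using assms restrict_coords_carrier[OF assms, of A] w_pos p
  by (intro powr_mono2 suminf_le suminf_nonneg)
    (auto simp: vcarrier_lp_space restrict_coords_def less_imp_le)

text \<open>Keeps a single term of the norm series: the k-th coordinate functional has norm at most
  \<open>w k powr (- 1 / p)\<close>.\<close>

lemma coord_le_vnorm:
  assumes "b \<in> vcarrier X"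
  shows "norm (b k) \<le> w k powr (- 1 / p) * vnorm X b"
proof -
  have "norm (b k) powr p * w k \<le> (\<Sum>n. norm (b n) powr p * w n)"
    using sum_le_suminf[of "\<lambda>n. norm (b n) powr p * w n" "{k}"] assms w_pos
    by (auto simp: vcarrier_lp_space less_imp_le)
  then have "(norm (b k) powr p * w k) powr (1 / p) \<le> vnorm X b"
    unfolding vnorm_lp_space using p w_pos[of k] by (intro powr_mono2) auto
  then have "norm (b k) * w k powr (1 / p) \<le> vnorm X b"
    using p w_pos[of k] by (simp add: powr_mult powr_powr)
  then have "w k powr (- 1 / p) * (norm (b k) * w k powr (1 / p)) \<le> w k powr (- 1 / p) * vnorm X b"
    by (rule mult_left_mono) simp
  moreover have "w k powr (- 1 / p) * (norm (b k) * w k powr (1 / p)) = norm (b k)"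
    using w_pos[of k] by (simp add: powr_minus)
  ultimately show ?thesis by (simp only:)
qed

lemma bounded_op_restrict: "bounded_op X Y (\<lambda>b. T (restrict_coords A b))"
  unfolding bounded_op_def
proof (intro conjI ballI allI exI)
  fix a b c assume ab: "a \<in> vcarrier X" "b \<in> vcarrier X"
  note rc = restrict_coords_carrier[OF ab(1), of A] restrict_coords_carrier[OF ab(2), of A]
  show "T (restrict_coords A a) \<in> vcarrier Y"
    by (rule T_op_bound(1)[OF rc(1) C_nonneg D_le_C])
  show "T (restrict_coords A (vadd X a b)) = vadd Y (T (restrict_coords A a)) (T (restrict_coords A b))"
    by (simp add: vadd_lp_space flip: T_op_add[OF rc]) (rule arg_cong[of _ _ T], auto simp: restrict_coords_def)
  show "T (restrict_coords A (vscale X c a)) = vscale Y c (T (restrict_coords A a))"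
    by (simp add: vscale_lp_space flip: T_op_scale[OF rc(1)]) (rule arg_cong[of _ _ T], auto simp: restrict_coords_def)
  have "vnorm Y (T (restrict_coords A a)) \<le> C * vnorm X (restrict_coords A a)"
    by (rule T_op_bound(2)[OF rc(1) C_nonneg D_le_C])
  also have "\<dots> \<le> C * vnorm X a"
    by (rule mult_left_mono[OF vnorm_restrict_coords_le[OF ab(1)] C_nonneg])
  finally show "vnorm Y (T (restrict_coords A a)) \<le> C * vnorm X a" .
qed

lemma restrict_coords_UNIV: "restrict_coords UNIV b = b"
  by (simp add: restrict_coords_def)

lemma bounded_op_T: "bounded_op X Y T"
  using bounded_op_restrict[of UNIV] by (simp add: restrict_coords_UNIV)

lemma vdiff_T_restrict:
  assumes "b \<in> vcarrier X"
  shows "vdiff Y (T b) (T (restrict_coords A b)) = T (restrict_coords (- A) b)"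
proof -
  have "(\<lambda>n. b n - restrict_coords A b n) = restrict_coords (- A) b"
    by (auto simp: restrict_coords_def)
  then show ?thesis
    by (simp add: T_op_diff assms restrict_coords_carrier)
qed

lemma op_norm_T_restrict_le: "op_norm X Y (\<lambda>b. T (restrict_coords A b)) \<le> (SUP n\<in>A. D n)"
proof -
  \<comment> \<open>Finiteness lets the supremum itself serve as the real constant \<open>c\<close>
    in \<open>T_op_bound\<close>.\<close>
  have "(SUP n\<in>A. D n) \<le> ennreal C" by (intro SUP_least D_le_C)
  then obtain c where c: "0 \<le> c" "(SUP n\<in>A. D n) = ennreal c"
    by (cases "SUP n\<in>A. D n") (auto simp: top_unique)
  have "vnorm Y (T (restrict_coords A b)) \<le> c * vnorm X b" if b: "b \<in> vcarrier X" for b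
  proof -
    have "D n \<le> ennreal c" if "restrict_coords A b n \<noteq> 0" for n
      using that SUP_upper[of n A D] by (auto simp: restrict_coords_def c split: if_splits)
    then have "vnorm Y (T (restrict_coords A b)) \<le> c * vnorm X (restrict_coords A b)"
      by (rule T_op_bound(2)[OF restrict_coords_carrier[OF b] c(1)])
    also have "\<dots> \<le> c * vnorm X b"
      by (rule mult_left_mono[OF vnorm_restrict_coords_le[OF b] c(1)])
    finally show ?thesis .
  qed
  then show ?thesis unfolding c(2) using c(1) by (rule op_norm_le)
qed

lemma op_norm_T_le: "op_norm X Y T \<le> (SUP n. D n)"
  using op_norm_T_restrict_le[of UNIV] by (simp add: restrict_coords_UNIV)

lemma op_norm_diff_restrict_le:
  "op_norm X Y (op_diff Y T (\<lambda>b. T (restrict_coords A b))) \<le> (SUP n\<in>- A. D n)"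
proof -
  have "op_norm X Y (op_diff Y T (\<lambda>b. T (restrict_coords A b)))
      = op_norm X Y (\<lambda>b. T (restrict_coords (- A) b))"
    unfolding op_norm_def op_diff_def by (rule SUP_cong) (auto simp: vdiff_T_restrict)
  then show ?thesis by (simp add: op_norm_T_restrict_le)
qed

section \<open>Finite rank and approximation numbers\<close>

definition monomial_class :: "nat \<Rightarrow> (real \<Rightarrow> complex) set" where
  "monomial_class n = ae_class \<mu> (\<lambda>t. of_real (tpow t (\<Lambda> n)))"

lemma T_restrict_singleton:
  "T (restrict_coords {n} b) = ae_class \<mu> (\<lambda>t. b n * of_real (tpow t (\<Lambda> n)))"
proof (rule T_op_eqI, rule AE_I2)
  fix t
  show "(\<lambda>k. restrict_coords {n} b k * of_real (tpow t (\<Lambda> k))) sums (b n * of_real (tpow t (\<Lambda> n)))"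
    using sums_finite[of "{n}" "\<lambda>k. restrict_coords {n} b k * of_real (tpow t (\<Lambda> k))"]
    by (simp add: restrict_coords_def)
qed

lemma T_restrict_singleton_scale: "T (restrict_coords {n} b) = vscale Y (b n) (monomial_class n)"
  by (simp add: T_restrict_singleton monomial_class_def Lp_space_scale)

lemma T_restrict_empty: "T (restrict_coords {} b) = vzero Y"
  by (intro trans[OF T_op_eqI[of _ "\<lambda>t. 0"]]) (simp_all add: restrict_coords_def Lp_space_zero)

lemma T_restrict_insert:
  assumes "n \<notin> A" "b \<in> vcarrier X"
  shows "T (restrict_coords (insert n A) b)
    = vadd Y (T (restrict_coords {n} b)) (T (restrict_coords A b))"
proof -
  have "restrict_coords (insert n A) b = (\<lambda>k. restrict_coords {n} b k + restrict_coords A b k)"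
    using assms(1) by (auto simp: restrict_coords_def)
  then show ?thesis by (simp add: T_op_add restrict_coords_carrier assms(2))
qed

lemma op_rank_restrict_le:
  assumes "finite A"
  shows "op_rank X Y (\<lambda>b. T (restrict_coords A b)) \<le> enat (card A)"
proof -
  let ?V = "(\<lambda>b. T (restrict_coords A b)) ` vcarrier X"
  \<comment> \<open>\<open>vdim\<close> admits only spanning sets inside the range; each monomial is
    the image of a unit vector.\<close>
  have "monomial_class n \<in> ?V" if "n \<in> A" for n
  proof (rule image_eqI)
    show "restrict_coords {n} (\<lambda>_. 1) \<in> vcarrier X"
      by (simp add: restrict_coords_finite_carrier)
    have "restrict_coords A (restrict_coords {n} (\<lambda>_. 1)) = restrict_coords {n} (\<lambda>_. 1)"
      using that by (auto simp: restrict_coords_def)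
    then show "monomial_class n = T (restrict_coords A (restrict_coords {n} (\<lambda>_. 1)))"
      by (simp add: T_restrict_singleton monomial_class_def)
  qed
  moreover have "T (restrict_coords B b) \<in> vspan Y (monomial_class ` A)"
    if "finite B" "B \<subseteq> A" "b \<in> vcarrier X" for B b
    using that
  proof (induction B)
    case empty
    then show ?case by (simp add: T_restrict_empty vspan_zero)
  next
    case (insert n B)
    then show ?case
      by (simp add: T_restrict_insert T_restrict_singleton_scale[of n] vspan_step)
  qed
  ultimately have "vdim Y ?V \<le> enat (card (monomial_class ` A))"
    unfolding vdim_def using assms by (intro INF_lower) auto
  \<comment> \<open>Only an inequality, since distinct indices may give the same class modulo null
    sets.\<close>
  also have "\<dots> \<le> enat (card A)"
    using card_image_le[OF assms] by simp
  finally show ?thesis by (simp add: op_rank_def)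
qed

lemma approx_number_le_decr_rearr: "approx_number X Y T (N + 1) \<le> decr_rearr D N"
  unfolding decr_rearr_def
proof (rule INF_greatest)
  fix A :: "nat set" assume A: "A \<in> {A. finite A \<and> card A = N}"
  have "op_rank X Y (\<lambda>b. T (restrict_coords A b)) < enat (N + 1)"
    using op_rank_restrict_le[of A] A by (auto intro: le_less_trans)
  then have "approx_number X Y T (N + 1) \<le> op_norm X Y (op_diff Y T (\<lambda>b. T (restrict_coords A b)))"
    unfolding approx_number_def by (intro INF_lower) (auto simp: bounded_op_restrict)
  then show "approx_number X Y T (N + 1) \<le> (SUP n\<in>- A. D n)"
    using op_norm_diff_restrict_le by (rule order_trans)
qed

section \<open>Compactness and the essential norm\<close>

lemma compact_op_restrict:
  assumes A: "finite A"
  shows "compact_op X Y (\<lambda>b. T (restrict_coords A b))"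
  unfolding compact_op_def
proof (intro conjI allI impI)
  fix x :: "nat \<Rightarrow> nat \<Rightarrow> complex"
  assume x: "\<forall>n. x n \<in> vcarrier X \<and> vnorm X (x n) \<le> 1"
  \<comment> \<open>By \<open>coord_le_vnorm\<close> this scaling puts all coordinates of the unit
    ball into the closed unit disc, the uniform bound under which a diagonal subsequence converges
    in every coordinate.\<close>
  define f where "f n k = x n k / of_real (w k powr (- 1 / p))" for n k
  have "norm (f n k) \<le> 1" for n k
  proof -
    have "norm (x n k) \<le> w k powr (- 1 / p) * vnorm X (x n)"
      using x by (intro coord_le_vnorm) auto
    also have "\<dots> \<le> w k powr (- 1 / p) * 1"
      using x by (intro mult_left_mono) auto
    finally show ?thesis using w_pos[of k] by (simp add: f_def norm_divide)
  qed
  then obtain r where r: "strict_mono r" "\<And>k. \<exists>l. (\<lambda>n. f (r n) k) \<longlonglongrightarrow> l"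
    using function_convergent_subsequence[of UNIV f 1] by (metis UNIV_I countableI_type)
  then obtain l where l: "\<And>k. (\<lambda>n. f (r n) k) \<longlonglongrightarrow> l k" by metis
  \<comment> \<open>The coordinatewise limit of the subsequence. It enters only through its
    restriction to \<open>A\<close>, which lies in the space because \<open>A\<close> is
    finite.\<close>
  define z where "z k = l k * of_real (w k powr (- 1 / p))" for k
  have z: "(\<lambda>n. x (r n) k) \<longlonglongrightarrow> z k" for k
  proof -
    have "(\<lambda>n. f (r n) k * of_real (w k powr (- 1 / p))) \<longlonglongrightarrow> z k"
      unfolding z_def by (intro tendsto_mult l tendsto_const)
    then show ?thesis using w_pos[of k] by (simp add: f_def)
  qed
  define d where "d n = (\<lambda>k. restrict_coords A (x (r n)) k - restrict_coords A z k)" for n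
  have d: "d n = restrict_coords A (\<lambda>k. x (r n) k - z k)" for n
    by (auto simp: d_def restrict_coords_def)
  have d_carrier: "d n \<in> vcarrier X" for n
    unfolding d by (rule restrict_coords_finite_carrier[OF A])
  have norm_d: "vnorm X (d n) = (\<Sum>k\<in>A. norm (x (r n) k - z k) powr p * w k) powr (1 / p)" for n
    unfolding vnorm_lp_space d
    by (subst suminf_finite[OF A]) (simp_all add: restrict_coords_def cong: sum.cong)
  \<comment> \<open>Over the finite set \<open>A\<close>, coordinatewise convergence is norm
    convergence, and the bound \<open>C\<close> carries it through \<open>T\<close>.\<close>
  have "(\<lambda>n. \<Sum>k\<in>A. norm (x (r n) k - z k) powr p * w k) \<longlonglongrightarrow> (\<Sum>k\<in>A. 0 powr p * w k)"
    using p by (intro tendsto_sum tendsto_mult tendsto_powr' tendsto_const tendsto_norm_zero LIM_zero z) auto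
  then have "(\<lambda>n. vnorm X (d n)) \<longlonglongrightarrow> 0 powr (1 / p)"
    unfolding norm_d using p w_pos
    by (intro tendsto_powr' tendsto_const) (auto intro!: always_eventually sum_nonneg simp: less_imp_le)
  then have "(\<lambda>n. C * vnorm X (d n)) \<longlonglongrightarrow> C * 0"
    by (intro tendsto_mult tendsto_const) simp
  then have lim: "(\<lambda>n. C * vnorm X (d n)) \<longlonglongrightarrow> 0" by simp
  have eq: "vdiff Y (T (restrict_coords A (x (r n)))) (T (restrict_coords A z)) = T (d n)" for n
    unfolding d_def by (intro T_op_diff restrict_coords_finite_carrier A)
  have "vnorm Y (T (d n)) \<le> C * vnorm X (d n)" for n
    by (rule T_op_bound(2)[OF d_carrier C_nonneg D_le_C])
  moreover have "0 \<le> vnorm Y (T (d n))" for n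
    by (simp add: T_op_eq d_carrier Lp_space_norm)
  ultimately have "(\<lambda>n. vnorm Y (T (d n))) \<longlonglongrightarrow> 0"
    by (intro real_tendsto_sandwich[OF _ _ tendsto_const lim]) auto
  then have "(\<lambda>n. vnorm Y (vdiff Y (T (restrict_coords A (x (r n)))) (T (restrict_coords A z)))) \<longlonglongrightarrow> 0"
    by (simp add: eq)
  moreover have "T (restrict_coords A z) \<in> vcarrier Y"
    by (rule T_op_bound(1)[OF restrict_coords_finite_carrier[OF A] C_nonneg D_le_C])
  ultimately show "\<exists>r y. strict_mono r \<and> y \<in> vcarrier Y \<and>
      (\<lambda>n. vnorm Y (vdiff Y (T (restrict_coords A (x (r n)))) y)) \<longlonglongrightarrow> 0"
    using r(1) by blast
qed (rule bounded_op_restrict)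

text \<open>The limsup is an infimum of tail suprema; for each \<open>N\<close> the first
  \<open>N\<close> coordinates provide a compact competitor whose error is bounded by the tail from
  \<open>N\<close> on.\<close>

lemma essential_norm_le_limsup: "essential_norm X Y T \<le> limsup D"
  unfolding limsup_INF_SUP
proof (rule INF_greatest)
  fix N :: nat
  have "essential_norm X Y T \<le> op_norm X Y (op_diff Y T (\<lambda>b. T (restrict_coords {..<N} b)))"
    unfolding essential_norm_def by (intro INF_lower) (simp add: compact_op_restrict)
  also have "\<dots> \<le> (SUP n\<in>- {..<N}. D n)"
    by (rule op_norm_diff_restrict_le)
  finally show "essential_norm X Y T \<le> (SUP n\<in>{N..}. D n)"
    by (simp add: Compl_lessThan)
qed

section \<open>The nuclear norm\<close>

lemma op_norm_restrict_singleton_le: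
  "op_norm X Y (\<lambda>b. T (restrict_coords {n} b))
    \<le> ennreal (w n powr (- 1 / p) * vnorm Y (monomial_class n))"
proof (rule op_norm_le)
  fix b assume b: "b \<in> vcarrier X"
  have "vnorm Y (T (restrict_coords {n} b)) = norm (b n) * vnorm Y (monomial_class n)"
    using p by (simp add: T_restrict_singleton monomial_class_def Lp_space_norm norm_mult powr_mult powr_powr)
  also have "\<dots> \<le> (w n powr (- 1 / p) * vnorm X b) * vnorm Y (monomial_class n)"
    by (intro mult_right_mono coord_le_vnorm b) (simp add: monomial_class_def Lp_space_norm)
  finally show "vnorm Y (T (restrict_coords {n} b))
      \<le> w n powr (- 1 / p) * vnorm Y (monomial_class n) * vnorm X b"
    by (simp add: mult_ac)
qed (simp add: monomial_class_def Lp_space_norm)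

lemma vpartial_sum_restrict:
  assumes "b \<in> vcarrier X"
  shows "vpartial_sum Y (\<lambda>n. T (restrict_coords {n} b)) N = T (restrict_coords {..<N} b)"
proof (induction N)
  case 0
  then show ?case by (simp add: T_restrict_empty)
next
  case (Suc N)
  have "restrict_coords {..<Suc N} b = (\<lambda>k. restrict_coords {..<N} b k + restrict_coords {N} b k)"
    by (auto simp: restrict_coords_def)
  then show ?case by (simp add: Suc T_op_add restrict_coords_carrier assms)
qed

text \<open>The tails of \<open>b\<close> tend to 0 in \<open>\<ell>\<^sup>p(w)\<close> and
  \<open>T\<close> is bounded. This is the pointwise convergence that \<open>nuclear_rep\<close>
  requires.\<close>

lemma T_restrict_tail_tendsto_0:
  assumes b: "b \<in> vcarrier X"
  shows "(\<lambda>N. vnorm Y (T (restrict_coords (- {..<N}) b))) \<longlonglongrightarrow> 0"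
proof -
  let ?f = "\<lambda>n. norm (b n) powr p * w n"
  have f: "summable ?f" using b by (simp add: vcarrier_lp_space)
  have "(\<Sum>n. norm (restrict_coords (- {..<N}) b n) powr p * w n) = suminf ?f - sum ?f {..<N}" for N
  proof -
    have eq: "(\<lambda>n. norm (restrict_coords (- {..<N}) b n) powr p * w n)
        = (\<lambda>n. ?f n - (if n \<in> {..<N} then ?f n else 0))"
      by (auto simp: restrict_coords_def)
    show ?thesis
      unfolding eq
      by (intro sums_unique[symmetric] sums_diff summable_sums f sums_If_finite_set finite_lessThan)
  qed
  then have norm_eq: "vnorm X (restrict_coords (- {..<N}) b) = (suminf ?f - sum ?f {..<N}) powr (1 / p)" for N
    by (simp add: vnorm_lp_space)
  have "(\<lambda>N. suminf ?f - sum ?f {..<N}) \<longlonglongrightarrow> suminf ?f - suminf ?f"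
    by (intro tendsto_diff tendsto_const summable_LIMSEQ f)
  then have "(\<lambda>N. suminf ?f - sum ?f {..<N}) \<longlonglongrightarrow> 0" by simp
  moreover have "sum ?f {..<N} \<le> suminf ?f" for N
    using w_pos by (intro sum_le_suminf f) (auto simp: less_imp_le)
  ultimately have "(\<lambda>N. vnorm X (restrict_coords (- {..<N}) b)) \<longlonglongrightarrow> 0 powr (1 / p)"
    unfolding norm_eq using p by (intro tendsto_powr' tendsto_const) auto
  then have "(\<lambda>N. C * vnorm X (restrict_coords (- {..<N}) b)) \<longlonglongrightarrow> C * 0"
    by (intro tendsto_mult tendsto_const) simp
  then have lim: "(\<lambda>N. C * vnorm X (restrict_coords (- {..<N}) b)) \<longlonglongrightarrow> 0" by simp
  have "vnorm Y (T (restrict_coords (- {..<N}) b)) \<le> C * vnorm X (restrict_coords (- {..<N}) b)" for N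
    by (rule T_op_bound(2)[OF restrict_coords_carrier[OF b] C_nonneg D_le_C])
  moreover have "0 \<le> vnorm Y (T (restrict_coords (- {..<N}) b))" for N
    by (simp add: T_op_eq restrict_coords_carrier b Lp_space_norm)
  ultimately show ?thesis
    by (intro real_tendsto_sandwich[OF _ _ tendsto_const lim]) auto
qed

lemma nuclear_norm_le:
  "nuclear_norm X Y T \<le> (\<Sum>n. ennreal (w n powr (- 1 / p) * vnorm Y (monomial_class n)))"
    (is "_ \<le> ?S")
proof (cases "?S < \<infinity>")
  case True
  let ?R = "\<lambda>n b. T (restrict_coords {n} b)"
  have le: "(\<Sum>n. op_norm X Y (?R n)) \<le> ?S"
    by (intro suminf_le op_norm_restrict_singleton_le summableI)
  \<comment> \<open>The rank drops to 0 when the monomial vanishes almost everywhere.\<close>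
  have "op_rank X Y (?R n) \<le> 1" for n
    using op_rank_restrict_le[of "{n}"] by (simp add: one_enat_def)
  moreover have "(\<lambda>N. vnorm Y (vdiff Y (T b) (vpartial_sum Y (\<lambda>n. ?R n b) N))) \<longlonglongrightarrow> 0"
    if "b \<in> vcarrier X" for b
    using T_restrict_tail_tendsto_0[OF that] by (simp add: vpartial_sum_restrict vdiff_T_restrict that)
  ultimately have "nuclear_rep X Y T ?R"
    unfolding nuclear_rep_def using le True by (auto simp: bounded_op_restrict intro: le_less_trans)
  then have "nuclear_norm X Y T \<le> (\<Sum>n. op_norm X Y (?R n))"
    unfolding nuclear_norm_def by (intro INF_lower) simp
  then show ?thesis using le by (rule order_trans)
qed (simp add: not_less top_unique)

section \<open>Schatten norms\<close>

lemma schatten_norm_le: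
  assumes "0 < r"
  shows "schatten_norm r X Y T \<le> epowr (\<Sum>n. epowr (D n) r) (1 / r)"
proof -
  \<comment> \<open>Approximation numbers start at 1 and rearrangements at 0, so
    \<open>Suc n\<close> is paired with \<open>n\<close>.\<close>
  have "(\<Sum>n. epowr (approx_number X Y T (Suc n)) r) \<le> (\<Sum>N. epowr (decr_rearr D N) r)"
    using approx_number_le_decr_rearr assms by (intro suminf_le summableI epowr_mono) auto
  also have "\<dots> \<le> (\<Sum>n. epowr (D n) r)"
    by (rule suminf_epowr_decr_rearr_le[OF assms])
  finally show ?thesis
    unfolding schatten_norm_def using assms by (intro epowr_mono) auto
qed

end

theorem proposition2p9:
  fixes p :: real and \<Lambda> w :: "nat \<Rightarrow> real" and \<mu> :: "real measure"
  assumes p: "p \<ge> 1"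
    and Lambda_nonneg: "\<And>n. \<Lambda> n \<ge> 0"
    and Lambda_mono: "mono \<Lambda>"
    and Lambda_summable: "summable (\<lambda>n. 1 / \<Lambda> (Suc n))"
    and Lambda_gap: "(INF n. \<Lambda> (Suc n) - \<Lambda> n) > 0"
    and w_pos: "\<And>n. w n > 0"
    and mu_sets: "sets \<mu> = sets (restrict_space borel {0..<1})"
    and mu_finite: "finite_measure \<mu>"
    and D_bounded: "\<exists>C::real. \<forall>n. D_num \<mu> \<Lambda> w p n \<le> ennreal C"
  shows "bounded_op (lp_space p w) (Lp_space p \<mu>) (T_op \<mu> \<Lambda>)
    \<and> (\<forall>N. approx_number (lp_space p w) (Lp_space p \<mu>) (T_op \<mu> \<Lambda>) (N + 1)
            \<le> decr_rearr (D_num \<mu> \<Lambda> w p) N)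
    \<and> op_norm (lp_space p w) (Lp_space p \<mu>) (T_op \<mu> \<Lambda>) \<le> (SUP n. D_num \<mu> \<Lambda> w p n)
    \<and> essential_norm (lp_space p w) (Lp_space p \<mu>) (T_op \<mu> \<Lambda>)
        \<le> limsup (\<lambda>n. D_num \<mu> \<Lambda> w p n)
    \<and> nuclear_norm (lp_space p w) (Lp_space p \<mu>) (T_op \<mu> \<Lambda>)
        \<le> (\<Sum>n. ennreal (w n powr (- 1 / p) *
                 vnorm (Lp_space p \<mu>) (ae_class \<mu> (\<lambda>t. of_real (tpow t (\<Lambda> n))))))
    \<and> (p = 2 \<longrightarrow> (\<forall>r>0. schatten_norm r (lp_space p w) (Lp_space p \<mu>) (T_op \<mu> \<Lambda>)
        \<le> epowr (\<Sum>n. epowr (D_num \<mu> \<Lambda> w 2 n) r) (1 / r)))"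
proof -
  obtain C :: real where "\<And>n. D_num \<mu> \<Lambda> w p n \<le> ennreal C"
    using D_bounded by blast
  \<comment> \<open>The given bound may be negative, in which case \<open>ennreal C\<close> is 0;
    the maximum supplies the sign condition of the locale.\<close>
  then have C: "D_num \<mu> \<Lambda> w p n \<le> ennreal (max 0 C)" for n
    by (rule order_trans) (simp add: ennreal_leI)
  interpret bounded_D_num p \<Lambda> w \<mu> "max 0 C"
    using p w_pos mu_sets C by unfold_locales simp_all
  show ?thesis
  proof (intro conjI allI impI)
    fix r :: real assume "p = 2" "0 < r"
    then show "schatten_norm r (lp_space p w) (Lp_space p \<mu>) (T_op \<mu> \<Lambda>)
        \<le> epowr (\<Sum>n. epowr (D_num \<mu> \<Lambda> w 2 n) r) (1 / r)"
      using schatten_norm_le[of r] by simp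
  qed (fact bounded_op_T approx_number_le_decr_rearr op_norm_T_le essential_norm_le_limsup
      nuclear_norm_le[unfolded monomial_class_def])+
qed

end
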